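(* Suppose the common subset $\mathcal{A}$ is nonempty. Then the online algorithm described in the context, run with parameters $V>0$ and $\alpha>0$, ensures the following for all integers $T\ge 1$ and all $x\in\mathcal{A}$: $$\frac{1}{T}\sum_{t=0}^{T-1} f_t(X_t)\le \frac{1}{T}\sum_{t=0}^{T-1} f_t(x)+\frac{B}{V}+\frac{VG^2}{2\alpha}+\frac{\alpha D^2}{VT}.$$ In particular, if we fix $\epsilon>0$ and define $V=1/\epsilon$, $\alpha=1/\epsilon^2$, then for all $T\ge 1/\epsilon^2$ (and all $x\in\mathcal{A}$) we have $$\frac{1}{T}\sum_{t=0}^{T-1} f_t(X_t)\le \frac{1}{T}\sum_{t=0}^{T-1} f_t(x)+O(\epsilon).$$
   Context: Setting. Fix positive integers $n,k$. $\mathcal{X}\subseteq\mathbb{R}^n$ is a convex compact set; $\|\cdot\|$ is the Euclidean norm; $D\ge 0$ is a constant with $\|x-y\|\le D$ for all $x,y\in\mathcal{X}$. $\{f_t\}_{t=0}^\infty$ and $\{g_{t,i}\}_{t=0}^\infty$ ($i\in\{1,\dots,k\}$) are sequences of continuous convex functions $\mathcal{X}\to\mathbb{R}$ (possibly nonsmooth). $F\ge 0$ is a constant with $|f_t(x)|\le F$ and $|g_{t,i}(x)|\le F$ for all $t$, $i$ and $x\in\mathcal{X}$. For every $x\in\mathcal{X}$ particular subgradients $f_t'(x)$, $g_{t,i}'(x)\in\mathbb{R}^n$ are fixed, i.e. $f_t(y)\ge f_t(x)+f_t'(x)^T(y-x)$ and $g_{t,i}(y)\ge g_{t,i}(x)+g_{t,i}'(x)^T(y-x)$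 for all $y\in\mathcal{X}$, and $G>0$ is a constant with $\|f_t'(x)\|\le G$ and $\|g_{t,i}'(x)\|\le G$ for all $t$, $i$, $x$. Common subset: $\mathcal{A}$ is the set of all $x\in\mathcal{X}$ such that $g_{t,i}(x)\le 0$ for all $i\in\{1,\dots,k\}$ and all $t\in\{0,1,2,\dots\}$. Constant: $B=\frac{k(F+GD)^2}{2}$. Algorithm with parameters $V>0$, $\alpha>0$. Fix $x_0\in\mathcal{X}$ and set $X_0=x_0$. Virtual queues satisfy $Q_i(0)=Q_i(1)=0$ and, for $t\in\{1,2,3,\dots\}$, $$Q_i(t+1)=\max\left[Q_i(t)+g_{t-1,i}(X_{t-1})+g_{t-1,i}'(X_{t-1})^T(X_t-X_{t-1}),\,0\right].$$ On each slot $t\in\{1,2,3,\dots\}$, $X_t$ is the (unique) minimizer over $x\in\mathcal{X}$ of $$\left[Vf_{t-1}'(X_{t-1})^T+\sum_{i=1}^kQ_i(t)g_{t-1,i}'(X_{t-1})^T\right]x+\alpha\|x-X_{t-1}\|^2.$$ $O(\epsilon)$ denotes a quantity at most $c\epsilon$ for a constant $c$ not depending on $\epsilon$ or $T$. *)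

theory Defs
  imports "HOL-Analysis.Analysis"
begin

definition is_subgradient_on ::
  "(real ^ 'n) set \<Rightarrow> (real ^ 'n \<Rightarrow> real) \<Rightarrow> real ^ 'n \<Rightarrow> real ^ 'n \<Rightarrow> bool" where
  "is_subgradient_on S h x v \<longleftrightarrow> (\<forall>y\<in>S. h y \<ge> h x + v \<bullet> (y - x))"

text \<open>Constraint functions are written \<open>g t i\<close> with time \<open>t\<close> and index \<open>i \<in> {1..k}\<close>;
  queues are written \<open>Q i t\<close>.\<close>

definition common_subset ::
  "(real ^ 'n) set \<Rightarrow> nat \<Rightarrow> (nat \<Rightarrow> nat \<Rightarrow> real ^ 'n \<Rightarrow> real) \<Rightarrow> (real ^ 'n) set" where
  "common_subset S k g = {x \<in> S. \<forall>i\<in>{1..k}. \<forall>t. g t i x \<le> 0}"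

definition B_const :: "nat \<Rightarrow> real \<Rightarrow> real \<Rightarrow> real \<Rightarrow> real" where
  "B_const k F G D = real k * (F + G * D)\<^sup>2 / 2"

text \<open>Here \<open>p\<close> is the previous decision, \<open>u\<close> the subgradient of the objective at \<open>p\<close>,
  \<open>w i\<close> the subgradient of the \<open>i\<close>-th constraint at \<open>p\<close>, and \<open>q i\<close> the current queue value.\<close>

definition slot_objective ::
  "nat \<Rightarrow> real \<Rightarrow> real \<Rightarrow> real ^ 'n \<Rightarrow> (nat \<Rightarrow> real ^ 'n) \<Rightarrow> (nat \<Rightarrow> real) \<Rightarrow> real ^ 'n
    \<Rightarrow> real ^ 'n \<Rightarrow> real" where
  "slot_objective k V \<alpha> u w q p x =
     (V *\<^sub>R u + (\<Sum>i=1..k. q i *\<^sub>R w i)) \<bullet> x + \<alpha> * (norm (x - p))\<^sup>2"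

text \<open>The minimizer of the slot objective exists and is unique, so that the algorithm is
  well defined when its decision is specified by \<open>is_arg_min\<close>.\<close>

lemma ex1_slot_minimizer:
  fixes S :: "(real ^ 'n) set"
  assumes "compact S" "convex S" "S \<noteq> {}" "\<alpha> > 0"
  shows "\<exists>!x. is_arg_min (slot_objective k V \<alpha> u w q p) (\<lambda>x. x \<in> S) x"
proof -
  define c where "c = V *\<^sub>R u + (\<Sum>i=1..k. q i *\<^sub>R w i)"
  let ?h = "\<lambda>x. c \<bullet> x + \<alpha> * (norm (x - p))\<^sup>2"
  have h: "slot_objective k V \<alpha> u w q p = ?h"
    by (simp add: fun_eq_iff slot_objective_def c_def)
  have "continuous_on S ?h"
    by (intro continuous_intros)
  then obtain x where x: "x \<in> S" "\<And>y. y \<in> S \<Longrightarrow> ?h x \<le> ?h y"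
    using continuous_attains_inf[of S ?h] assms by blast
  have uniq: "a = b" if a: "a \<in> S" "\<And>y. y \<in> S \<Longrightarrow> ?h a \<le> ?h y"
    and b: "b \<in> S" "\<And>y. y \<in> S \<Longrightarrow> ?h b \<le> ?h y" for a b
  proof -
    let ?m = "(1/2) *\<^sub>R a + (1/2) *\<^sub>R b"
    have m: "?m \<in> S"
      using assms(2) a(1) b(1) by (intro convexD) auto
    have "?h a + ?h b - 2 * ?h ?m = \<alpha> / 2 * (norm (a - b))\<^sup>2"
      unfolding power2_norm_eq_inner
      by (simp add: inner_simps algebra_simps inner_commute)
    moreover have "?h a + ?h b - 2 * ?h ?m \<le> 0"
      using add_mono[OF a(2)[OF m] b(2)[OF m]] by (simp only: mult_2 diff_le_0_iff_le)
    ultimately have "\<alpha> / 2 * (norm (a - b))\<^sup>2 \<le> 0" by linarith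
    then show "a = b"
      using assms(4) by (simp add: mult_le_0_iff)
  qed
  show ?thesis
    unfolding h is_arg_min_linorder
    using x uniq by blast
qed

text \<open>\<open>online_run S k f' g g' V \<alpha> x0 X Q\<close> holds iff \<open>X\<close> and \<open>Q\<close> are the decisions and virtual
  queues generated by the algorithm with parameters \<open>V\<close> and \<open>\<alpha>\<close> from the initial point \<open>x0\<close>.
  The functions \<open>f t\<close> enter only through the chosen subgradients \<open>f' t\<close>.\<close>

definition online_run ::
  "(real ^ 'n) set \<Rightarrow> nat \<Rightarrow> (nat \<Rightarrow> real ^ 'n \<Rightarrow> real ^ 'n)
    \<Rightarrow> (nat \<Rightarrow> nat \<Rightarrow> real ^ 'n \<Rightarrow> real) \<Rightarrow> (nat \<Rightarrow> nat \<Rightarrow> real ^ 'n \<Rightarrow> real ^ 'n)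
    \<Rightarrow> real \<Rightarrow> real \<Rightarrow> real ^ 'n \<Rightarrow> (nat \<Rightarrow> real ^ 'n) \<Rightarrow> (nat \<Rightarrow> nat \<Rightarrow> real) \<Rightarrow> bool" where
  "online_run S k f' g g' V \<alpha> x0 X Q \<longleftrightarrow>
     X 0 = x0 \<and>
     (\<forall>i\<in>{1..k}. Q i 0 = 0 \<and> Q i 1 = 0) \<and>
     (\<forall>t\<ge>1. \<forall>i\<in>{1..k}.
        Q i (t + 1) =
          max (Q i t + g (t - 1) i (X (t - 1)) + g' (t - 1) i (X (t - 1)) \<bullet> (X t - X (t - 1))) 0) \<and>
     (\<forall>t\<ge>1. is_arg_min
        (slot_objective k V \<alpha> (f' (t - 1) (X (t - 1))) (\<lambda>i. g' (t - 1) i (X (t - 1)))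
          (\<lambda>i. Q i t) (X (t - 1)))
        (\<lambda>x. x \<in> S) (X t))"

end

theory Submission
  imports Defs
begin

text \<open>
  The argument weighs the cost against the drift of the Lyapunov function
  \<open>L t = (\<Sum>i. (Q i t)\<^sup>2) / 2\<close>. In slot \<open>t + 1\<close> the algorithm moves from \<open>p = X t\<close> to
  \<open>y = X (t + 1)\<close>. Squaring the queue update bounds the drift by \<open>B + (\<Sum>i. Q i (t + 1) * h i)\<close>,
  where \<open>h i\<close> is the \<open>i\<close>-th constraint, linearized at \<open>p\<close> and evaluated at \<open>y\<close>. Up to terms
  independent of \<open>y\<close>, this sum plus the penalty \<open>V f' t p \<bullet> y\<close> is the linear part of the
  function that the algorithm minimizes.

  So \<open>y\<close> can be compared with a fixed \<open>x\<close> of the common subset. Because the slot objective is a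
  quadratic with leading coefficient \<open>\<alpha>\<close>, the minimizer beats \<open>x\<close> by at least
  \<open>\<alpha> \<parallel>x - y\<parallel>\<^sup>2\<close> (\<open>quadratic_pushback\<close>). At \<open>x\<close> the linearized constraints are nonpositive, as
  they lie below \<open>g t i x \<le> 0\<close>, so all queue terms drop out; the linearized cost of going from
  \<open>p\<close> to \<open>x\<close> is at most \<open>f t x - f t p\<close>. What remains on the side of \<open>y\<close> is
  \<open>V f' t p \<bullet> (y - p) + \<alpha> \<parallel>y - p\<parallel>\<^sup>2\<close>, which is never below \<open>- V\<^sup>2 G\<^sup>2 / (4 \<alpha>)\<close>
  (\<open>linear_plus_prox_ge\<close>). Together these estimates form \<open>drift_plus_penalty_step\<close>.

  Summed over the slots, both the drift and the differences
  \<open>\<alpha> (\<parallel>x - X t\<parallel>\<^sup>2 - \<parallel>x - X (t + 1)\<parallel>\<^sup>2)\<close> telescope, and at most \<open>\<alpha> D\<^sup>2\<close> is left of the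
  latter (\<open>online_run_regret\<close>). Dividing by \<open>V T\<close> gives the first claim, and the choice
  \<open>V = 1/\<epsilon>\<close>, \<open>\<alpha> = 1/\<epsilon>\<^sup>2\<close>, \<open>T \<ge> 1/\<epsilon>\<^sup>2\<close> makes each of its three error terms \<open>O(\<epsilon>)\<close>.
\<close>

text \<open>Moving from the minimizer \<open>y\<close> towards \<open>x\<close>, to \<open>s y + (1 - s) x\<close>, cannot decrease the quadratic.
  The value there is that of the chord minus \<open>\<alpha> s (1 - s) \<parallel>x - y\<parallel>\<^sup>2\<close>, so dividing by
  \<open>1 - s\<close> and letting \<open>s\<close> tend to 1 gives the full gap.\<close>

lemma quadratic_pushback:
  fixes S :: "'a::real_inner set"
  assumes "convex S" "x \<in> S" "y \<in> S"
    and min: "\<And>z. z \<in> S \<Longrightarrow> c \<bullet> y + \<alpha> * (norm (y - p))\<^sup>2 \<le> c \<bullet> z + \<alpha> * (norm (z - p))\<^sup>2"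
  shows "c \<bullet> y + \<alpha> * (norm (y - p))\<^sup>2 + \<alpha> * (norm (x - y))\<^sup>2 \<le> c \<bullet> x + \<alpha> * (norm (x - p))\<^sup>2"
proof -
  let ?h = "\<lambda>z. c \<bullet> z + \<alpha> * (norm (z - p))\<^sup>2"
  have "s * (\<alpha> * (norm (x - y))\<^sup>2) \<le> ?h x - ?h y" if s: "0 < s" "s < 1" for s
  proof -
    define z where "z = s *\<^sub>R y + (1 - s) *\<^sub>R x"
    have "z \<in> S"
      unfolding z_def using assms s by (intro convexD) auto
    then have "?h y \<le> ?h z" by (rule min)
    also have "?h z = s * ?h y + (1 - s) * ?h x - s * (1 - s) * (\<alpha> * (norm (x - y))\<^sup>2)"
      unfolding z_def power2_norm_eq_inner
      by (simp add: inner_simps algebra_simps inner_commute)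
    finally have "(1 - s) * (s * (\<alpha> * (norm (x - y))\<^sup>2)) \<le> (1 - s) * (?h x - ?h y)"
      by (simp add: algebra_simps)
    then show ?thesis using s by simp
  qed
  then have "\<alpha> * (norm (x - y))\<^sup>2 \<le> ?h x - ?h y"
    by (rule field_le_mult_one_interval)
  then show ?thesis by simp
qed

text \<open>Complete the square in \<open>norm d\<close>: the proximal term pays for all but a fixed part of the
  decrease that a linear term can bring.\<close>

lemma linear_plus_prox_ge:
  fixes u d :: "'a::real_inner"
  assumes "V \<ge> 0" "\<alpha> > 0" "norm u \<le> G"
  shows "- (V\<^sup>2 * G\<^sup>2 / (4 * \<alpha>)) \<le> V * (u \<bullet> d) + \<alpha> * (norm d)\<^sup>2"
proof -
  have "\<bar>u \<bullet> d\<bar> \<le> G * norm d"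
    using Cauchy_Schwarz_ineq2[of u d] mult_right_mono[OF assms(3), of "norm d"] by simp
  then have "- (V * (G * norm d)) \<le> V * (u \<bullet> d)"
    using mult_left_mono[of "- (G * norm d)" "u \<bullet> d" V] assms(1) by simp
  moreover have "0 \<le> (2 * \<alpha> * norm d - V * G)\<^sup>2 / (4 * \<alpha>)"
    using assms(2) by simp
  moreover have "(2 * \<alpha> * norm d - V * G)\<^sup>2 / (4 * \<alpha>)
      = \<alpha> * (norm d)\<^sup>2 - V * (G * norm d) + V\<^sup>2 * G\<^sup>2 / (4 * \<alpha>)"
    using assms(2) by (simp add: power2_eq_square field_simps)
  ultimately show ?thesis by linarith
qed

text \<open>One slot of the algorithm, with \<open>p\<close> the previous and \<open>y\<close> the new decision, \<open>b i\<close> the value of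
  the \<open>i\<close>-th constraint at \<open>p\<close>, and \<open>x\<close> the point of comparison. Each square of a queue grows by
  at most \<open>2 q i h + h\<^sup>2\<close>; the part linear in \<open>h\<close> belongs to the slot objective, where
  \<open>y\<close> may be traded for \<open>x\<close>.\<close>

lemma drift_plus_penalty_step:
  fixes S :: "(real ^ 'n) set"
  assumes "convex S" "x \<in> S" "V \<ge> 0" "\<alpha> > 0" "norm u \<le> G"
    and min: "is_arg_min (slot_objective k V \<alpha> u w q p) (\<lambda>x. x \<in> S) y"
    and q: "\<And>i. i \<in> {1..k} \<Longrightarrow> q i \<ge> 0"
    and feas: "\<And>i. i \<in> {1..k} \<Longrightarrow> b i + w i \<bullet> (x - p) \<le> 0"
    and M: "\<And>i. i \<in> {1..k} \<Longrightarrow> \<bar>b i + w i \<bullet> (y - p)\<bar> \<le> M"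
  shows "(\<Sum>i=1..k. (max (q i + b i + w i \<bullet> (y - p)) 0)\<^sup>2) / 2 - (\<Sum>i=1..k. (q i)\<^sup>2) / 2
    \<le> real k * M\<^sup>2 / 2 + V * (u \<bullet> (x - p)) + V\<^sup>2 * G\<^sup>2 / (4 * \<alpha>)
      + \<alpha> * ((norm (x - p))\<^sup>2 - (norm (x - y))\<^sup>2)"
proof -
  define c where "c = V *\<^sub>R u + (\<Sum>i=1..k. q i *\<^sub>R w i)"
  have y: "y \<in> S" "\<And>z. z \<in> S \<Longrightarrow>
      c \<bullet> y + \<alpha> * (norm (y - p))\<^sup>2 \<le> c \<bullet> z + \<alpha> * (norm (z - p))\<^sup>2"
    using min unfolding is_arg_min_linorder slot_objective_def c_def by auto
  have push: "c \<bullet> y + \<alpha> * (norm (y - p))\<^sup>2 + \<alpha> * (norm (x - y))\<^sup>2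
      \<le> c \<bullet> x + \<alpha> * (norm (x - p))\<^sup>2"
    by (rule quadratic_pushback[OF assms(1,2) y])
  \<comment> \<open>up to a constant, the linear part of the slot objective is the penalty plus the queue-weighted
      constraints of the drift bound, which makes the values at \<open>x\<close> and \<open>y\<close> comparable\<close>
  have c: "c \<bullet> z = V * (u \<bullet> (z - p)) + (\<Sum>i=1..k. q i * (b i + w i \<bullet> (z - p)))
      + (c \<bullet> p - (\<Sum>i=1..k. q i * b i))" for z
    unfolding c_def
    by (simp add: inner_simps inner_sum_left algebra_simps sum.distrib sum_subtractf)
  have "(\<Sum>i=1..k. (max (q i + b i + w i \<bullet> (y - p)) 0)\<^sup>2)
      \<le> (\<Sum>i=1..k. (q i)\<^sup>2 + 2 * (q i * (b i + w i \<bullet> (y - p))) + M\<^sup>2)"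
  proof (rule sum_mono)
    fix i assume i: "i \<in> {1..k}"
    let ?h = "b i + w i \<bullet> (y - p)"
    have "(max (q i + b i + w i \<bullet> (y - p)) 0)\<^sup>2 \<le> (q i + ?h)\<^sup>2"
      by (simp add: max_def add.assoc)
    also have "\<dots> = (q i)\<^sup>2 + 2 * (q i * ?h) + ?h\<^sup>2"
      by (simp add: power2_sum)
    also have "?h\<^sup>2 \<le> M\<^sup>2"
      using power_mono[OF M[OF i], of 2] by simp
    finally show "(max (q i + b i + w i \<bullet> (y - p)) 0)\<^sup>2
        \<le> (q i)\<^sup>2 + 2 * (q i * ?h) + M\<^sup>2" by simp
  qed
  then have drift: "(\<Sum>i=1..k. (max (q i + b i + w i \<bullet> (y - p)) 0)\<^sup>2)
      \<le> (\<Sum>i=1..k. (q i)\<^sup>2) + 2 * (\<Sum>i=1..k. q i * (b i + w i \<bullet> (y - p))) + real k * M\<^sup>2"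
    by (simp add: sum.distrib sum_distrib_left)
  have "(\<Sum>i=1..k. q i * (b i + w i \<bullet> (x - p))) \<le> 0"
    using q feas by (intro sum_nonpos mult_nonneg_nonpos) auto
  then show ?thesis
    using drift push c[of x] c[of y] linear_plus_prox_ge[OF assms(3-5), of "y - p"]
    unfolding right_diff_distrib by linarith
qed

text \<open>The regret bound before division by \<open>V T\<close>. Slot \<open>t + 1\<close> of the algorithm works with the
  functions of time \<open>t\<close>, so the Lyapunov function telescopes from \<open>Q i 1 = 0\<close> to
  \<open>Q i (T + 1)\<close>.\<close>

lemma online_run_regret:
  fixes S :: "(real ^ 'n) set"
  assumes run: "online_run S k f' g g' V \<alpha> x0 X Q"
    and "convex S" "x0 \<in> S" "V \<ge> 0" "\<alpha> > 0"
    and diam: "\<And>x y. x \<in> S \<Longrightarrow> y \<in> S \<Longrightarrow> norm (x - y) \<le> D"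
    and g_le: "\<And>t i x. i \<in> {1..k} \<Longrightarrow> x \<in> S \<Longrightarrow> \<bar>g t i x\<bar> \<le> F"
    and f': "\<And>t x. x \<in> S \<Longrightarrow> is_subgradient_on S (f t) x (f' t x)"
    and g': "\<And>t i x. i \<in> {1..k} \<Longrightarrow> x \<in> S \<Longrightarrow> is_subgradient_on S (g t i) x (g' t i x)"
    and f'_le: "\<And>t x. x \<in> S \<Longrightarrow> norm (f' t x) \<le> G"
    and g'_le: "\<And>t i x. i \<in> {1..k} \<Longrightarrow> x \<in> S \<Longrightarrow> norm (g' t i x) \<le> G"
    and x: "x \<in> common_subset S k g"
  shows "V * (\<Sum>t<T. f t (X t)) \<le> V * (\<Sum>t<T. f t x)
    + real T * (B_const k F G D + V\<^sup>2 * G\<^sup>2 / (4 * \<alpha>)) + \<alpha> * D\<^sup>2"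
proof -
  have X0: "X 0 = x0" and Q1: "\<And>i. i \<in> {1..k} \<Longrightarrow> Q i 1 = 0"
    using run by (auto simp: online_run_def)
  have Q_step: "Q i (Suc (Suc t)) = max (Q i (Suc t) + g t i (X t) + g' t i (X t) \<bullet> (X (Suc t) - X t)) 0"
    if "i \<in> {1..k}" for i t
    using run that unfolding online_run_def by (auto dest!: spec[of _ "Suc t"])
  have X_step: "is_arg_min (slot_objective k V \<alpha> (f' t (X t)) (\<lambda>i. g' t i (X t))
      (\<lambda>i. Q i (Suc t)) (X t)) (\<lambda>x. x \<in> S) (X (Suc t))" for t
    using run unfolding online_run_def by (auto dest!: spec[of _ "Suc t"])
  have X: "X t \<in> S" for t
    using X0 \<open>x0 \<in> S\<close> X_step[of "t - 1"] by (cases t) (auto simp: is_arg_min_def)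
  have Q: "Q i (Suc t) \<ge> 0" if "i \<in> {1..k}" for i t
    using that Q1 Q_step by (cases t) auto
  have xS: "x \<in> S" and gx: "\<And>t i. i \<in> {1..k} \<Longrightarrow> g t i x \<le> 0"
    using x by (auto simp: common_subset_def)
  define L where "L t = (\<Sum>i=1..k. (Q i (Suc t))\<^sup>2) / 2" for t
  define E where "E = B_const k F G D + V\<^sup>2 * G\<^sup>2 / (4 * \<alpha>)"
  have step: "L (Suc t) - L t + V * f t (X t)
      \<le> V * f t x + E + \<alpha> * ((norm (x - X t))\<^sup>2 - (norm (x - X (Suc t)))\<^sup>2)" for t
  proof -
    have Lsuc: "(\<Sum>i=1..k. (Q i (Suc (Suc t)))\<^sup>2) =
        (\<Sum>i=1..k. (max (Q i (Suc t) + g t i (X t) + g' t i (X t) \<bullet> (X (Suc t) - X t)) 0)\<^sup>2)"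
      by (intro sum.cong refl) (simp only: Q_step)
    have "L (Suc t) - L t \<le> real k * (F + G * D)\<^sup>2 / 2 + V * (f' t (X t) \<bullet> (x - X t))
        + V\<^sup>2 * G\<^sup>2 / (4 * \<alpha>) + \<alpha> * ((norm (x - X t))\<^sup>2 - (norm (x - X (Suc t)))\<^sup>2)"
      unfolding L_def Lsuc
    proof (rule drift_plus_penalty_step[OF \<open>convex S\<close> xS \<open>V \<ge> 0\<close> \<open>\<alpha> > 0\<close> f'_le[OF X] X_step Q])
      fix i assume i: "i \<in> {1..k}"
      show "g t i (X t) + g' t i (X t) \<bullet> (x - X t) \<le> 0"
        using g'[OF i X, of t t] xS gx[OF i, of t] by (force simp: is_subgradient_on_def)
      have "\<bar>g' t i (X t) \<bullet> (X (Suc t) - X t)\<bar> \<le> norm (g' t i (X t)) * norm (X (Suc t) - X t)"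
        by (rule Cauchy_Schwarz_ineq2)
      also have "\<dots> \<le> G * D"
        by (intro mult_mono g'_le[OF i X] diam[OF X X] order_trans[OF norm_ge_zero g'_le[OF i X]]
            norm_ge_zero)
      finally show "\<bar>g t i (X t) + g' t i (X t) \<bullet> (X (Suc t) - X t)\<bar> \<le> F + G * D"
        using g_le[OF i X, of t t] by linarith
    qed
    moreover have "V * (f' t (X t) \<bullet> (x - X t)) \<le> V * (f t x - f t (X t))"
      using f'[OF X, of t] xS \<open>V \<ge> 0\<close>
      by (intro mult_left_mono) (auto simp: is_subgradient_on_def algebra_simps)
    ultimately show ?thesis
      by (simp add: E_def B_const_def right_diff_distrib)
  qed
  have "L T - L 0 + V * (\<Sum>t<T. f t (X t))
      \<le> V * (\<Sum>t<T. f t x) + real T * E + \<alpha> * ((norm (x - X 0))\<^sup>2 - (norm (x - X T))\<^sup>2)"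
  proof (induction T)
    case (Suc T)
    then show ?case
      using step[of T] by (simp add: algebra_simps)
  qed simp
  moreover have "L 0 = 0" "0 \<le> L T"
    using Q1 by (auto simp: L_def intro!: sum_nonneg)
  moreover have "\<alpha> * ((norm (x - X 0))\<^sup>2 - (norm (x - X T))\<^sup>2) \<le> \<alpha> * D\<^sup>2"
    using power_mono[OF diam[OF xS X[of 0]], of 2] \<open>\<alpha> > 0\<close>
    by (intro mult_left_mono) (auto intro: order_trans[OF diff_left_mono[of 0]])
  ultimately show ?thesis
    unfolding E_def by linarith
qed

theorem theorem1:
  fixes S :: "(real ^ 'n) set"
    and k :: nat
    and D F G :: real
    and f :: "nat \<Rightarrow> real ^ 'n \<Rightarrow> real"
    and f' :: "nat \<Rightarrow> real ^ 'n \<Rightarrow> real ^ 'n"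
    and g :: "nat \<Rightarrow> nat \<Rightarrow> real ^ 'n \<Rightarrow> real"
    and g' :: "nat \<Rightarrow> nat \<Rightarrow> real ^ 'n \<Rightarrow> real ^ 'n"
    and x0 :: "real ^ 'n"
  assumes "k \<ge> 1"
    and "convex S" and "compact S"
    and "D \<ge> 0" and "\<And>x y. x \<in> S \<Longrightarrow> y \<in> S \<Longrightarrow> norm (x - y) \<le> D"
    and "\<And>t. continuous_on S (f t)" and "\<And>t. convex_on S (f t)"
    and "\<And>t i. i \<in> {1..k} \<Longrightarrow> continuous_on S (g t i)"
    and "\<And>t i. i \<in> {1..k} \<Longrightarrow> convex_on S (g t i)"
    and "F \<ge> 0"
    and "\<And>t x. x \<in> S \<Longrightarrow> \<bar>f t x\<bar> \<le> F"
    and "\<And>t i x. i \<in> {1..k} \<Longrightarrow> x \<in> S \<Longrightarrow> \<bar>g t i x\<bar> \<le> F"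
    and "\<And>t x. x \<in> S \<Longrightarrow> is_subgradient_on S (f t) x (f' t x)"
    and "\<And>t i x. i \<in> {1..k} \<Longrightarrow> x \<in> S \<Longrightarrow> is_subgradient_on S (g t i) x (g' t i x)"
    and "G > 0"
    and "\<And>t x. x \<in> S \<Longrightarrow> norm (f' t x) \<le> G"
    and "\<And>t i x. i \<in> {1..k} \<Longrightarrow> x \<in> S \<Longrightarrow> norm (g' t i x) \<le> G"
    and "x0 \<in> S"
    and "common_subset S k g \<noteq> {}"
  shows
    "(\<forall>V>0. \<forall>\<alpha>>0. \<forall>X Q. online_run S k f' g g' V \<alpha> x0 X Q \<longrightarrow>
        (\<forall>T::nat. T \<ge> 1 \<longrightarrow> (\<forall>x \<in> common_subset S k g.
           1 / real T * (\<Sum>t=0..<T. f t (X t))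
             \<le> 1 / real T * (\<Sum>t=0..<T. f t x)
               + B_const k F G D / V + V * G\<^sup>2 / (2 * \<alpha>) + \<alpha> * D\<^sup>2 / (V * real T)))) \<and>
     (\<exists>c::real. \<forall>\<epsilon>>0. \<forall>X Q. online_run S k f' g g' (1 / \<epsilon>) (1 / \<epsilon>\<^sup>2) x0 X Q \<longrightarrow>
        (\<forall>T::nat. real T \<ge> 1 / \<epsilon>\<^sup>2 \<longrightarrow> (\<forall>x \<in> common_subset S k g.
           1 / real T * (\<Sum>t=0..<T. f t (X t))
             \<le> 1 / real T * (\<Sum>t=0..<T. f t x) + c * \<epsilon>)))"
proof -
  have regret: "1 / real T * (\<Sum>t=0..<T. f t (X t))
      \<le> 1 / real T * (\<Sum>t=0..<T. f t x)
        + B_const k F G D / V + V * G\<^sup>2 / (2 * \<alpha>) + \<alpha> * D\<^sup>2 / (V * real T)"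
    if V: "V > 0" and \<alpha>: "\<alpha> > 0" and run: "online_run S k f' g g' V \<alpha> x0 X Q"
      and T: "T \<ge> 1" and x: "x \<in> common_subset S k g" for V \<alpha> X Q T x
  proof -
    have "V * (\<Sum>t=0..<T. f t (X t)) \<le> V * (\<Sum>t=0..<T. f t x)
        + real T * (B_const k F G D + V\<^sup>2 * G\<^sup>2 / (4 * \<alpha>)) + \<alpha> * D\<^sup>2"
      unfolding atLeast0LessThan
      by (rule online_run_regret[OF run assms(2,18) less_imp_le[OF V] \<alpha> assms(5,12-14,16,17) x])
    then have "(V * (\<Sum>t=0..<T. f t (X t))) / (V * real T) \<le> (V * (\<Sum>t=0..<T. f t x)
        + real T * (B_const k F G D + V\<^sup>2 * G\<^sup>2 / (4 * \<alpha>)) + \<alpha> * D\<^sup>2) / (V * real T)"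
      using V by (intro divide_right_mono) auto
    then have "1 / real T * (\<Sum>t=0..<T. f t (X t)) \<le> 1 / real T * (\<Sum>t=0..<T. f t x)
        + B_const k F G D / V + V * G\<^sup>2 / (4 * \<alpha>) + \<alpha> * D\<^sup>2 / (V * real T)"
      using V T by (simp add: add_divide_distrib distrib_left power2_eq_square)
    moreover have "V * G\<^sup>2 / (4 * \<alpha>) \<le> V * G\<^sup>2 / (2 * \<alpha>)"
      using V \<alpha> by (intro divide_left_mono) auto
    ultimately show ?thesis by linarith
  qed
  have "1 / real T * (\<Sum>t=0..<T. f t (X t)) \<le> 1 / real T * (\<Sum>t=0..<T. f t x)
      + (B_const k F G D + G\<^sup>2 / 2 + D\<^sup>2) * \<epsilon>"
    if \<epsilon>: "\<epsilon> > 0" and run: "online_run S k f' g g' (1 / \<epsilon>) (1 / \<epsilon>\<^sup>2) x0 X Q"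
      and T: "real T \<ge> 1 / \<epsilon>\<^sup>2" and x: "x \<in> common_subset S k g" for \<epsilon> X Q T x
  proof -
    have "real T > 0"
      using \<epsilon> by (intro less_le_trans[OF _ T]) simp
    have "1 / real T \<le> \<epsilon>\<^sup>2"
      using T \<epsilon> \<open>real T > 0\<close> by (simp add: field_simps)
    then have "D\<^sup>2 / \<epsilon> * (1 / real T) \<le> D\<^sup>2 / \<epsilon> * \<epsilon>\<^sup>2"
      using \<epsilon> by (intro mult_left_mono) auto
    then have "(1 / \<epsilon>\<^sup>2) * D\<^sup>2 / ((1 / \<epsilon>) * real T) \<le> D\<^sup>2 * \<epsilon>"
      using \<epsilon> by (simp add: power2_eq_square)
    moreover have "(1 / \<epsilon>) * G\<^sup>2 / (2 * (1 / \<epsilon>\<^sup>2)) = G\<^sup>2 / 2 * \<epsilon>"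
      using \<epsilon> by (simp add: power2_eq_square)
    moreover have "B_const k F G D / (1 / \<epsilon>) = B_const k F G D * \<epsilon>"
      by simp
    moreover have "1 / \<epsilon> > 0" "1 / \<epsilon>\<^sup>2 > 0" "T \<ge> 1"
      using \<epsilon> \<open>real T > 0\<close> by simp_all
    ultimately show ?thesis
      using regret[OF _ _ run _ x] unfolding distrib_right by fastforce
  qed
  with regret show ?thesis by blast
qed

end
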